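(* Let $T>0$ and let $s:[0,\ell]\to\mathbb R$ be piecewise $C^1$. Any solution, with even $T$-periodic data $y^0$, of the scalar equation $$\mathcal F_P(y^0):=\tfrac{\mathcal I-\mathcal R}{2}\,\mathcal T^{-T/4}\,\mathcal E^\ell\,y^0=0$$ provides a tile which generates, by reflections and translations, a solution of the compressible Euler equations $p_x+u_t=0$, $u_x-\partial_tv(p,s(x))=0$ on $\mathbb R^2$ which is $4\ell$-periodic in space and $T$-periodic in time. A solution, with even $T$-periodic data $y^0$, of $$\mathcal F_A(y^0):=\tfrac{\mathcal I-\mathcal R}{2}\,\mathcal E^\ell\,y^0=0$$ similarly produces a solution which is $2\ell$-periodic in space and $T$-periodic in time.
   Context: $x$ is the material coordinate; $v=v(p,s)$ is a given smooth constitutive function with $v_p<0$; piecewise $C^1$ means bounded with finitely many jumps, all interior. Solutions are classical: $p,u$ continuous (also across entropy jumps), equations satisfied almost everywhere. On $T$-periodic functions of $t$: $\mathcal If=f$, $\mathcal R[f](t)=f(-t)$, $\mathcal T^\tau[f](t)=f(t-\tau)$. Within the symmetry class ($p$ even and $u$ odd in $t$) the state is encoded by the scalar $y=p+u$, so $p=\frac{\mathcal I+\mathcal R}2y$, $u=\frac{\mathcal I-\mathcal R}2y$. The evolution operator is $\mathcal E^x(y^0):=y(x,\cdot)$, where $y=p+u$ and $(p,u)$ is the classical solution on $[0,\ell]$, evolved in $x$, of the system with data at $x=0$ given by the even and odd parts of $y^0$; it is assumed that this classical solution exists on all of $[0,\ell]$ (e.g. $y^0$ close to a constant in $H^b$,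 $b>3/2$). The entropy is extended to $x\in\mathbb R$ as an even, $2\ell$-periodic function. The 'tile' is the solution on $[0,\ell]\times[0,T]$, to be extended by reflections in $x$ about $x=0$ and about $x=\ell$ (the latter combined with a shift by $T/2$ in $t$ for $\mathcal F_P$). *)

theory Defs
  imports "HOL-Analysis.Analysis"
begin

section \<open>Operators on functions of time\<close>

definition reflect :: "(real \<Rightarrow> real) \<Rightarrow> real \<Rightarrow> real" where
  "reflect f = (\<lambda>t. f (- t))"

definition shift :: "real \<Rightarrow> (real \<Rightarrow> real) \<Rightarrow> real \<Rightarrow> real" where
  "shift \<tau> f = (\<lambda>t. f (t - \<tau>))"

definition even_part :: "(real \<Rightarrow> real) \<Rightarrow> real \<Rightarrow> real" where
  "even_part f = (\<lambda>t. (f t + reflect f t) / 2)"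

definition odd_part :: "(real \<Rightarrow> real) \<Rightarrow> real \<Rightarrow> real" where
  "odd_part f = (\<lambda>t. (f t - reflect f t) / 2)"

definition periodic :: "real \<Rightarrow> (real \<Rightarrow> 'b) \<Rightarrow> bool" where
  "periodic T f \<longleftrightarrow> (\<forall>t. f (t + T) = f t)"

definition even_fun :: "(real \<Rightarrow> real) \<Rightarrow> bool" where
  "even_fun f \<longleftrightarrow> (\<forall>t. f (- t) = f t)"

definition odd_fun :: "(real \<Rightarrow> real) \<Rightarrow> bool" where
  "odd_fun f \<longleftrightarrow> (\<forall>t. f (- t) = - f t)"


section \<open>Constitutive function and entropy profile\<close>

text \<open>\<open>Ck_on S k f\<close>: all iterated directional derivatives of \<open>f\<close> up to order \<open>k\<close> exist
  (as Frechet derivatives) and are continuous on the open set \<open>S\<close>.\<close>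

primrec Ck_on ::
  "'a::real_normed_vector set \<Rightarrow> nat \<Rightarrow> ('a \<Rightarrow> 'b::real_normed_vector) \<Rightarrow> bool" where
  "Ck_on S 0 f \<longleftrightarrow> continuous_on S f"
| "Ck_on S (Suc k) f \<longleftrightarrow>
     (\<forall>z\<in>S. f differentiable (at z)) \<and> (\<forall>h. Ck_on S k (\<lambda>z. frechet_derivative f (at z) h))"

definition smooth_on :: "'a::real_normed_vector set \<Rightarrow> ('a \<Rightarrow> 'b::real_normed_vector) \<Rightarrow> bool" where
  "smooth_on S f \<longleftrightarrow> (\<forall>k. Ck_on S k f)"

text \<open>The set \<open>D\<close> consists of the admissible pressures: \<open>D = UNIV\<close> for a constitutive function
  defined for all \<open>p\<close>, and \<open>D = {0<..}\<close> for, say, a \<open>\<gamma>\<close>-law gas.\<close>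

definition constitutive :: "real set \<Rightarrow> (real \<Rightarrow> real \<Rightarrow> real) \<Rightarrow> bool" where
  "constitutive D v \<longleftrightarrow>
     open D \<and> smooth_on (D \<times> UNIV) (\<lambda>(q, \<sigma>). v q \<sigma>) \<and>
     (\<forall>q\<in>D. \<forall>\<sigma>. deriv (\<lambda>r. v r \<sigma>) q < 0)"

text \<open>The exceptional set \<open>J\<close> lies in the open interval, so there is no jump at \<open>0\<close> or \<open>l\<close>.
  The derivative is one-sided at the endpoints, so that only the values of \<open>s\<close> on \<open>{0..l}\<close>
  matter.  Nothing is required of the value of \<open>s\<close> at a jump.\<close>

definition piecewise_C1 :: "real \<Rightarrow> (real \<Rightarrow> real) \<Rightarrow> bool" where
  "piecewise_C1 l s \<longleftrightarrow> bounded (s ` {0..l}) \<and>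
     (\<exists>J s'. finite J \<and> J \<subseteq> {0<..<l} \<and>
        (\<forall>x\<in>{0..l} - J. (s has_real_derivative s' x) (at x within {0..l})) \<and>
        continuous_on ({0..l} - J) s' \<and>
        (\<forall>x\<in>J. (\<exists>a. (s \<longlongrightarrow> a) (at_left x)) \<and> (\<exists>b. (s \<longlongrightarrow> b) (at_right x))))"

text \<open>The argument of \<open>s\<close> is the distance from \<open>x\<close> to the nearest multiple of \<open>2 * l\<close>.\<close>

definition even_periodic_ext :: "real \<Rightarrow> (real \<Rightarrow> real) \<Rightarrow> real \<Rightarrow> real" where
  "even_periodic_ext l s = (\<lambda>x. s \<bar>x - 2 * l * of_int (round (x / (2 * l)))\<bar>)"


section \<open>Classical solutions and evolution in the material coordinate\<close>

text \<open>The system \<open>p\<^sub>x + u\<^sub>t = 0\<close>, \<open>u\<^sub>x - \<partial>\<^sub>t v(p, s(x)) = 0\<close> at the point \<open>(x, t)\<close>; the functions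
  \<open>p\<close> and \<open>u\<close> take \<open>x\<close> first and \<open>t\<close> second.\<close>

definition euler_at ::
  "(real \<Rightarrow> real \<Rightarrow> real) \<Rightarrow> (real \<Rightarrow> real) \<Rightarrow> (real \<Rightarrow> real \<Rightarrow> real) \<Rightarrow> (real \<Rightarrow> real \<Rightarrow> real)
     \<Rightarrow> real \<Rightarrow> real \<Rightarrow> bool" where
  "euler_at v s p u x t \<longleftrightarrow> (\<exists>px ut ux vt.
     ((\<lambda>\<xi>. p \<xi> t) has_real_derivative px) (at x) \<and>
     ((\<lambda>\<tau>. u x \<tau>) has_real_derivative ut) (at t) \<and>
     ((\<lambda>\<xi>. u \<xi> t) has_real_derivative ux) (at x) \<and>
     ((\<lambda>\<tau>. v (p x \<tau>) (s x)) has_real_derivative vt) (at t) \<and>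
     px + ut = 0 \<and> ux - vt = 0)"

text \<open>Classical solutions on \<open>X \<times> \<real>\<close>; boundary points of an interval \<open>X\<close> do not matter in the
  almost-everywhere clause.\<close>

definition classical_solution ::
  "real set \<Rightarrow> (real \<Rightarrow> real \<Rightarrow> real) \<Rightarrow> (real \<Rightarrow> real) \<Rightarrow> real set
     \<Rightarrow> (real \<Rightarrow> real \<Rightarrow> real) \<Rightarrow> (real \<Rightarrow> real \<Rightarrow> real) \<Rightarrow> bool" where
  "classical_solution D v s X p u \<longleftrightarrow>
     continuous_on (X \<times> UNIV) (\<lambda>(x, t). p x t) \<and>
     continuous_on (X \<times> UNIV) (\<lambda>(x, t). u x t) \<and>
     (\<forall>x\<in>X. \<forall>t. p x t \<in> D) \<and>
     (AE z in (lborel :: (real \<times> real) measure).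
        fst z \<in> X \<longrightarrow> euler_at v s p u (fst z) (snd z))"

text \<open>Solutions on \<open>[0, l]\<close> in the symmetry class, with data at \<open>x = 0\<close> the even and odd parts
  of \<open>y0\<close>.\<close>

definition tile_solution ::
  "real set \<Rightarrow> (real \<Rightarrow> real \<Rightarrow> real) \<Rightarrow> (real \<Rightarrow> real) \<Rightarrow> real \<Rightarrow> real \<Rightarrow> (real \<Rightarrow> real)
     \<Rightarrow> (real \<Rightarrow> real \<Rightarrow> real) \<Rightarrow> (real \<Rightarrow> real \<Rightarrow> real) \<Rightarrow> bool" where
  "tile_solution D v s l T y0 p u \<longleftrightarrow>
     classical_solution D v s {0..l} p u \<and>
     (\<forall>x\<in>{0..l}. periodic T (p x) \<and> periodic T (u x) \<and> even_fun (p x) \<and> odd_fun (u x)) \<and>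
     p 0 = even_part y0 \<and> u 0 = odd_part y0"

text \<open>\<open>E x y0\<close> is the state \<open>y = p + u\<close> at \<open>x\<close> evolved from \<open>y0\<close>, for every \<open>y0\<close> that has a
  solution on all of \<open>[0, l]\<close>.  Uniqueness of that solution is not built in: any map \<open>E\<close> that
  follows, for each \<open>y0\<close>, one solution with data \<open>y0\<close> qualifies.\<close>

definition evolution_operator ::
  "real set \<Rightarrow> (real \<Rightarrow> real \<Rightarrow> real) \<Rightarrow> (real \<Rightarrow> real) \<Rightarrow> real \<Rightarrow> real
     \<Rightarrow> (real \<Rightarrow> (real \<Rightarrow> real) \<Rightarrow> real \<Rightarrow> real) \<Rightarrow> bool" where
  "evolution_operator D v s l T E \<longleftrightarrow>
     (\<forall>y0. (\<exists>p u. tile_solution D v s l T y0 p u) \<longrightarrow>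
        (\<exists>p u. tile_solution D v s l T y0 p u \<and> (\<forall>x\<in>{0..l}. E x y0 = (\<lambda>t. p x t + u x t))))"

definition F_P ::
  "(real \<Rightarrow> (real \<Rightarrow> real) \<Rightarrow> real \<Rightarrow> real) \<Rightarrow> real \<Rightarrow> real \<Rightarrow> (real \<Rightarrow> real) \<Rightarrow> real \<Rightarrow> real" where
  "F_P E l T y0 = odd_part (shift (- (T / 4)) (E l y0))"

definition F_A ::
  "(real \<Rightarrow> (real \<Rightarrow> real) \<Rightarrow> real \<Rightarrow> real) \<Rightarrow> real \<Rightarrow> (real \<Rightarrow> real) \<Rightarrow> real \<Rightarrow> real" where
  "F_A E l y0 = odd_part (E l y0)"

text \<open>The pair \<open>p, u\<close> on the whole plane restricts on \<open>[0, l]\<close> to the tile encoded by \<open>y\<close>, and is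
  obtained from it by the reflection \<open>(p, u) \<mapsto> (p, - u)\<close> about \<open>x = 0\<close>, and the same reflection
  about \<open>x = l\<close> combined with a shift by \<open>c\<close> in \<open>t\<close>.  The tile and these rules determine
  \<open>p\<close> and \<open>u\<close> everywhere.\<close>

definition generated_by_tile ::
  "real \<Rightarrow> real \<Rightarrow> (real \<Rightarrow> real \<Rightarrow> real) \<Rightarrow> (real \<Rightarrow> real \<Rightarrow> real) \<Rightarrow> (real \<Rightarrow> real \<Rightarrow> real) \<Rightarrow> bool" where
  "generated_by_tile l c y p u \<longleftrightarrow>
     (\<forall>x\<in>{0..l}. p x = even_part (y x) \<and> u x = odd_part (y x)) \<and>
     (\<forall>x t. p (- x) t = p x t \<and> u (- x) t = - u x t) \<and>
     (\<forall>x t. p (2 * l - x) t = p x (t + c) \<and> u (2 * l - x) t = - u x (t + c))"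


lemma even_periodic_ext_eq:
  assumes "0 < l" "x \<in> {0..l}"
  shows "even_periodic_ext l s x = s x"
proof (cases "x = l")
  case True
  have "x / (2 * l) = 1 / 2" using True assms by simp
  then have "round (x / (2 * l)) = 1" by (simp add: round_def)
  then show ?thesis using True assms by (simp add: even_periodic_ext_def)
next
  case False
  then have "x / (2 * l) + 1 / 2 < 1" "0 \<le> x / (2 * l)" using assms by (auto simp: field_simps)
  then have "round (x / (2 * l)) = 0" by (simp add: round_def floor_eq_iff)
  then show ?thesis using assms by (simp add: even_periodic_ext_def)
qed

lemma even_periodic_ext_periodic:
  assumes "0 < l"
  shows "even_periodic_ext l s (x + 2 * l) = even_periodic_ext l s x"
proof -
  have "(x + 2 * l) / (2 * l) + 1 / 2 = (x / (2 * l) + 1 / 2) + 1"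
    using assms by (simp add: field_simps)
  then have "round ((x + 2 * l) / (2 * l)) = round (x / (2 * l)) + 1"
    unfolding round_def by (metis floor_add_int of_int_1)
  then show ?thesis by (simp add: even_periodic_ext_def algebra_simps)
qed

lemma even_periodic_ext_even:
  assumes "0 < l"
  shows "even_periodic_ext l s (- x) = even_periodic_ext l s x"
proof -
  define a where "a = x / (2 * l)"
  have x: "x = 2 * l * a" using assms by (simp add: a_def)
  have eq: "even_periodic_ext l s (2 * l * b) = s (2 * l * \<bar>b - of_int (round b)\<bar>)" for b
  proof -
    have "2 * l * b - 2 * l * of_int (round b) = 2 * l * (b - of_int (round b))"
      by (simp add: algebra_simps)
    then show ?thesis using assms by (simp add: even_periodic_ext_def abs_mult)
  qed
  have "\<bar>- a - of_int (round (- a))\<bar> = \<bar>a - of_int (round a)\<bar>"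
  proof (rule antisym)
    show "\<bar>- a - of_int (round (- a))\<bar> \<le> \<bar>a - of_int (round a)\<bar>"
      using round_diff_minimal[of "- a" "- round a"] by simp
    show "\<bar>a - of_int (round a)\<bar> \<le> \<bar>- a - of_int (round (- a))\<bar>"
      using round_diff_minimal[of a "- round (- a)"] by simp
  qed
  then show ?thesis using eq[of a] eq[of "- a"] x by simp
qed

end

theory Submission
  imports Defs
begin

text \<open>The system is invariant under time translations and under the reflection
  \<open>x \<mapsto> - x\<close>, \<open>(p, u) \<mapsto> (p, - u)\<close>, provided that the entropy is even.  Reflecting the
  tile about \<open>x = 0\<close>, and about \<open>x = l\<close> with a time shift by \<open>c\<close>, therefore yields a
  solution away from the lines \<open>x = k l\<close>, which form a null set; the only question is whether the
  pieces fit together continuously along these lines.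

  Along \<open>x = 0\<close> they fit if and only if \<open>u = 0\<close> there, which is the evenness of the data
  \<open>y0\<close>.  Along \<open>x = l\<close> they fit if and only if \<open>p(l, t + c) = p(l, t)\<close> and
  \<open>u(l, t + c) = - u(l, t)\<close>.  For \<open>c = 0\<close> this says \<open>u(l, \<cdot>) = 0\<close>, which is \<open>F_A = 0\<close>.
  For \<open>c = T / 2\<close> it is \<open>F_P = 0\<close>: the function \<open>y(l, \<cdot>)\<close> is then even about
  \<open>T / 4\<close>, and composing this reflection with the parity of \<open>p\<close> and \<open>u\<close> about
  \<open>0\<close> gives a relation under the shift by \<open>T / 2\<close>, whose even and odd parts are the two
  required identities (lemmas \<open>F_P_matching\<close> and \<open>F_A_matching\<close>).

  The composition of the two reflections is the translation by \<open>2 l\<close> in \<open>x\<close> together with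
  the shift by \<open>c\<close> in \<open>t\<close>.  As \<open>2 c\<close> is a period in time, the solution has spatial
  period \<open>4 l\<close>, and \<open>2 l\<close> if \<open>c = 0\<close>.  It is well defined for the same reason: a point
  of the plane determines the element of the reflection group that moves it into the tile only up to
  relations that act trivially, by the matching conditions on the boundary and by \<open>2 c\<close>-periodicity
  elsewhere (lemma \<open>tile_extension_exists\<close>).\<close>

section \<open>The reflection group acting on the plane\<close>

definition reflection_symmetric ::
  "real \<Rightarrow> real \<Rightarrow> (real \<Rightarrow> real \<Rightarrow> real) \<Rightarrow> (real \<Rightarrow> real \<Rightarrow> real) \<Rightarrow> bool" where
  "reflection_symmetric l c p u \<longleftrightarrow>
     (\<forall>x t. p (- x) t = p x t \<and> u (- x) t = - u x t) \<and>
     (\<forall>x t. p (2 * l - x) t = p x (t + c) \<and> u (2 * l - x) t = - u x (t + c))"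

text \<open>Serves for the product of the two reflections and, with \<open>f\<close> constant in its second
  argument, for plain periodicity.\<close>

lemma skew_periodic_int:
  fixes f :: "real \<Rightarrow> real \<Rightarrow> 'a" and n :: int
  assumes step: "\<And>x t. f (x + a) t = f x (t + c)"
  shows "f (x + of_int n * a) t = f x (t + of_int n * c)"
proof (induction n arbitrary: x t rule: int_induct[where k = 0])
  case base
  then show ?case by simp
next
  case (step1 i)
  have "f (x + of_int (i + 1) * a) t = f (x + of_int i * a) (t + c)"
    using step[of "x + of_int i * a" t] by (simp add: algebra_simps)
  then show ?case using step1(2)[of x "t + c"] by (simp add: algebra_simps)
next
  case (step2 i)
  have "f (x + of_int (i - 1) * a) t = f (x + of_int i * a) (t - c)"
    using step[of "x + of_int (i - 1) * a" "t - c"] by (simp add: algebra_simps)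
  then show ?case using step2(2)[of x "t - c"] by (simp add: algebra_simps)
qed

lemma periodic_int:
  fixes f :: "real \<Rightarrow> 'a" and n :: int
  assumes "periodic T f"
  shows "f (t + of_int n * T) = f t"
  using skew_periodic_int[of "\<lambda>x _. f x" T 0 t n 0] assms by (simp add: periodic_def)

lemma reflection_symmetric_translation:
  assumes "reflection_symmetric l c p u"
  shows "p (x + of_int n * (2 * l)) t = p x (t + of_int n * c)"
    and "u (x + of_int n * (2 * l)) t = u x (t + of_int n * c)"
proof -
  have "p (x + 2 * l) t = p x (t + c)" "u (x + 2 * l) t = u x (t + c)" for x t
    using assms unfolding reflection_symmetric_def
    by (metis add.commute diff_minus_eq_add minus_minus)+
  then show "p (x + of_int n * (2 * l)) t = p x (t + of_int n * c)"
    "u (x + of_int n * (2 * l)) t = u x (t + of_int n * c)"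
    using skew_periodic_int[of p "2 * l" c] skew_periodic_int[of u "2 * l" c] by blast+
qed

text \<open>The group elements are \<open>(x, t) \<mapsto> (\<epsilon> (x - 2 l n), t + n c)\<close> with \<open>\<epsilon> = 1\<close> or
  \<open>\<epsilon> = - 1\<close>; they fix \<open>p\<close> and multiply \<open>u\<close> by \<open>\<epsilon>\<close>.\<close>

lemma reflection_symmetric_group:
  assumes sym: "reflection_symmetric l c p u" and "\<epsilon> \<in> {1, - 1}"
  shows "p (\<epsilon> * (x - of_int n * (2 * l))) (t + of_int n * c) = p x t"
    and "u (\<epsilon> * (x - of_int n * (2 * l))) (t + of_int n * c) = \<epsilon> * u x t"
proof -
  have "p (x - of_int n * (2 * l)) (t + of_int n * c) = p x t"
    "u (x - of_int n * (2 * l)) (t + of_int n * c) = u x t"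
    using reflection_symmetric_translation[OF sym, of "x - of_int n * (2 * l)" n t] by simp_all
  moreover have "p (\<epsilon> * z) r = p z r" "u (\<epsilon> * z) r = \<epsilon> * u z r" for z r
    using assms unfolding reflection_symmetric_def by auto
  ultimately show "p (\<epsilon> * (x - of_int n * (2 * l))) (t + of_int n * c) = p x t"
    "u (\<epsilon> * (x - of_int n * (2 * l))) (t + of_int n * c) = \<epsilon> * u x t"
    by simp_all
qed

text \<open>Strips of even index are translates of the tile, strips of odd index are translates of its
  mirror image.\<close>

lemma strip_to_tile:
  fixes k :: int and l :: real
  obtains n :: int and \<epsilon> :: real where "\<epsilon> \<in> {1, - 1}"
    and "\<And>x. x \<in> {of_int k * l..of_int (k + 1) * l} \<Longrightarrow> \<epsilon> * (x - of_int n * (2 * l)) \<in> {0..l}"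
proof (cases "even k")
  case True
  then obtain n where "k = 2 * n" by blast
  then show ?thesis by (intro that[of 1 n]) (auto simp: algebra_simps)
next
  case False
  then obtain m where "k = 2 * m + 1" by (blast elim: oddE)
  then show ?thesis by (intro that[of "- 1" "m + 1"]) (auto simp: algebra_simps)
qed

lemma in_strip:
  fixes x l :: real
  assumes "0 < l"
  shows "x \<in> {of_int \<lfloor>x / l\<rfloor> * l..<of_int (\<lfloor>x / l\<rfloor> + 1) * l}"
  using assms floor_divide_lower[of l x] floor_divide_upper[of l x] by (simp add: algebra_simps)

lemma point_to_tile:
  fixes x l :: real
  assumes "0 < l"
  obtains n :: int and \<epsilon> :: real where "\<epsilon> \<in> {1, - 1}" and "\<epsilon> * (x - of_int n * (2 * l)) \<in> {0..l}"
proof -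
  have "x \<in> {of_int \<lfloor>x / l\<rfloor> * l..of_int (\<lfloor>x / l\<rfloor> + 1) * l}"
    using in_strip[OF assms, of x] by simp
  then show ?thesis using strip_to_tile[of "\<lfloor>x / l\<rfloor>" l] that by metis
qed


section \<open>Extension of the tile to the plane\<close>

text \<open>A multiple of \<open>2 l\<close> at distance at most \<open>l\<close> from \<open>x\<close> moves \<open>x\<close> into
  \<open>[- l, l]\<close>; the entropy extension uses the same choice.\<close>

definition extend_p :: "real \<Rightarrow> real \<Rightarrow> (real \<Rightarrow> real \<Rightarrow> real) \<Rightarrow> real \<Rightarrow> real \<Rightarrow> real" where
  "extend_p l c p = (\<lambda>x t. let n = of_int (round (x / (2 * l))) in
     p \<bar>x - n * (2 * l)\<bar> (t + n * c))"

definition extend_u :: "real \<Rightarrow> real \<Rightarrow> (real \<Rightarrow> real \<Rightarrow> real) \<Rightarrow> real \<Rightarrow> real \<Rightarrow> real" where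
  "extend_u l c u = (\<lambda>x t. let n = of_int (round (x / (2 * l))) in
     sgn (x - n * (2 * l)) * u \<bar>x - n * (2 * l)\<bar> (t + n * c))"

lemma nearest_multiple:
  fixes x l :: real
  assumes "0 < l"
  shows "\<bar>x - of_int (round (x / (2 * l))) * (2 * l)\<bar> \<le> l"
proof -
  have "\<bar>x / (2 * l) - of_int (round (x / (2 * l)))\<bar> * (2 * l) \<le> 1 / 2 * (2 * l)"
    using of_int_round_abs_le[of "x / (2 * l)"] assms
    by (intro mult_right_mono) (simp_all add: abs_minus_commute)
  moreover have "\<bar>x / (2 * l) - of_int (round (x / (2 * l)))\<bar> * (2 * l)
      = \<bar>(x / (2 * l) - of_int (round (x / (2 * l)))) * (2 * l)\<bar>"
    using assms by (simp add: abs_mult)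
  ultimately show ?thesis using assms by (simp add: left_diff_distrib)
qed

text \<open>At odd multiples of \<open>l\<close> there are two nearest multiples of \<open>2 l\<close>; the matching
  conditions at \<open>x = l\<close> make the two resulting values agree.\<close>

lemma extend_eq:
  assumes "0 < l" and near: "\<bar>x - of_int n * (2 * l)\<bar> \<le> l"
    and match: "\<And>t. p l (t + c) = p l t" "\<And>t. u l (t + c) = - u l t"
  shows "extend_p l c p x t = p \<bar>x - of_int n * (2 * l)\<bar> (t + of_int n * c)"
    and "extend_u l c u x t =
           sgn (x - of_int n * (2 * l)) * u \<bar>x - of_int n * (2 * l)\<bar> (t + of_int n * c)"
proof -
  define m where "m = round (x / (2 * l))"
  have m: "\<bar>x - of_int m * (2 * l)\<bar> \<le> l" unfolding m_def by (rule nearest_multiple[OF assms(1)])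
  have "\<bar>of_int (m - n) * (2 * l)\<bar> \<le> 2 * l" using m near by (simp add: algebra_simps)
  then have "\<bar>real_of_int (m - n)\<bar> \<le> 1" using assms(1) by (simp add: abs_mult)
  then have "\<bar>m - n\<bar> \<le> 1" by linarith
  then consider "m = n" | "m = n + 1" | "n = m + 1" by linarith
  then have "p \<bar>x - of_int m * (2 * l)\<bar> (t + of_int m * c)
        = p \<bar>x - of_int n * (2 * l)\<bar> (t + of_int n * c) \<and>
      sgn (x - of_int m * (2 * l)) * u \<bar>x - of_int m * (2 * l)\<bar> (t + of_int m * c)
        = sgn (x - of_int n * (2 * l)) * u \<bar>x - of_int n * (2 * l)\<bar> (t + of_int n * c)"
  proof cases
    case 1
    then show ?thesis by simp
  next
    case 2
    then have "x - of_int n * (2 * l) = l" "x - of_int m * (2 * l) = - l"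
      using m near by (auto simp: algebra_simps)
    then show ?thesis using 2 assms(1) match(1)[of "t + of_int n * c"] match(2)[of "t + of_int n * c"]
      by (simp add: algebra_simps)
  next
    case 3
    then have "x - of_int m * (2 * l) = l" "x - of_int n * (2 * l) = - l"
      using m near by (auto simp: algebra_simps)
    then show ?thesis using 3 assms(1) match(1)[of "t + of_int m * c"] match(2)[of "t + of_int m * c"]
      by (simp add: algebra_simps)
  qed
  then show "extend_p l c p x t = p \<bar>x - of_int n * (2 * l)\<bar> (t + of_int n * c)"
    "extend_u l c u x t =
      sgn (x - of_int n * (2 * l)) * u \<bar>x - of_int n * (2 * l)\<bar> (t + of_int n * c)"
    by (simp_all add: extend_p_def extend_u_def Let_def m_def)
qed

text \<open>Reflection about \<open>x = 0\<close> replaces \<open>n\<close> by \<open>- n\<close>, and reflection about \<open>x = l\<close>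
  replaces \<open>n\<close> by \<open>1 - n\<close>; in both cases the time shift changes by \<open>2 n c\<close>, besides the
  prescribed \<open>c\<close>, so that \<open>2 c\<close>-periodicity restores it.\<close>

lemma tile_extension_exists:
  assumes "0 < l"
    and per: "\<And>x. x \<in> {0..l} \<Longrightarrow> periodic (2 * c) (p x) \<and> periodic (2 * c) (u x)"
    and u0: "\<And>t. u 0 t = 0"
    and match: "\<And>t. p l (t + c) = p l t" "\<And>t. u l (t + c) = - u l t"
  obtains P U where "reflection_symmetric l c P U"
    and "\<And>x. x \<in> {0..l} \<Longrightarrow> P x = p x \<and> U x = u x"
proof
  show "reflection_symmetric l c (extend_p l c p) (extend_u l c u)"
    unfolding reflection_symmetric_def
  proof (intro conjI allI)
    fix x t
    define n where "n = round (x / (2 * l))"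
    define r where "r = x - of_int n * (2 * l)"
    have r: "\<bar>r\<bar> \<le> l" unfolding r_def n_def by (rule nearest_multiple[OF assms(1)])
    note E = extend_eq[where p = p and u = u and c = c, OF assms(1) _ match]
    have x: "extend_p l c p x q = p \<bar>r\<bar> (q + of_int n * c)"
      "extend_u l c u x q = sgn r * u \<bar>r\<bar> (q + of_int n * c)" for q
      using E[of x n q] r by (simp_all add: r_def)
    have r0: "- x - of_int (- n) * (2 * l) = - r" by (simp add: r_def)
    have rl: "2 * l - x - of_int (1 - n) * (2 * l) = - r" by (simp add: r_def algebra_simps)
    have P: "p \<bar>r\<bar> (q - of_int n * c) = p \<bar>r\<bar> (q + of_int n * c)"
      "u \<bar>r\<bar> (q - of_int n * c) = u \<bar>r\<bar> (q + of_int n * c)" for q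
      using periodic_int[of "2 * c" "p \<bar>r\<bar>" "q - of_int n * c" n]
        periodic_int[of "2 * c" "u \<bar>r\<bar>" "q - of_int n * c" n] per[of "\<bar>r\<bar>"] r
      by (simp_all add: algebra_simps)
    show "extend_p l c p (- x) t = extend_p l c p x t"
      "extend_u l c u (- x) t = - extend_u l c u x t"
      using E[of "- x" "- n" t, unfolded r0] r P[of t] by (simp_all add: x sgn_minus)
    have "t + of_int (1 - n) * c = (t + c) - of_int n * c" by (simp add: algebra_simps)
    note El = E[of "2 * l - x" "1 - n" t, unfolded rl this]
    show "extend_p l c p (2 * l - x) t = extend_p l c p x (t + c)"
      "extend_u l c u (2 * l - x) t = - extend_u l c u x (t + c)"
      using El r P[of "t + c"] by (simp_all add: x sgn_minus)
  qed
  fix x assume "x \<in> {0..l}"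
  then show "extend_p l c p x = p x \<and> extend_u l c u x = u x"
    using extend_eq[where p = p and u = u and c = c and n = 0, OF assms(1) _ match, of x] u0
    by (cases "x = 0") (auto simp: fun_eq_iff)
qed


section \<open>The extension is a classical solution\<close>

lemma even_periodic_ext_group:
  assumes "0 < l" and "\<epsilon> \<in> {1, - 1}"
  shows "even_periodic_ext l s (\<epsilon> * (x - of_int n * (2 * l))) = even_periodic_ext l s x"
proof -
  have "even_periodic_ext l s (x - of_int n * (2 * l)) = even_periodic_ext l s x"
    using periodic_int[of "2 * l" "even_periodic_ext l s" "x - of_int n * (2 * l)" n]
      even_periodic_ext_periodic[OF assms(1)]
    by (simp add: periodic_def)
  then show ?thesis using assms even_periodic_ext_even[OF assms(1), of s "x - of_int n * (2 * l)"]
    by auto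
qed

text \<open>Under \<open>x \<mapsto> \<epsilon> x\<close> and \<open>u \<mapsto> \<epsilon> u\<close>, both terms of the first equation are multiplied by
  \<open>\<epsilon>\<close> and both terms of the second one by \<open>\<epsilon>\<^sup>2 = 1\<close>.\<close>

lemma euler_at_group:
  assumes "\<epsilon> \<in> {1, - 1}"
    and p: "\<And>x t. p (\<epsilon> * (x - a)) (t + b) = p x t"
    and u: "\<And>x t. u (\<epsilon> * (x - a)) (t + b) = \<epsilon> * u x t"
    and s: "\<And>x. s (\<epsilon> * (x - a)) = s x"
    and eu: "euler_at v s p u (\<epsilon> * (x - a)) (t + b)"
  shows "euler_at v s p u x t"
proof -
  have \<epsilon>: "\<epsilon> * (\<epsilon> * r) = r" for r using assms(1) by auto
  from eu obtain px ut ux vt where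
    px: "((\<lambda>\<xi>. p \<xi> (t + b)) has_real_derivative px) (at (\<epsilon> * (x - a)))" and
    ut: "((\<lambda>\<tau>. u (\<epsilon> * (x - a)) \<tau>) has_real_derivative ut) (at (t + b))" and
    ux: "((\<lambda>\<xi>. u \<xi> (t + b)) has_real_derivative ux) (at (\<epsilon> * (x - a)))" and
    vt: "((\<lambda>\<tau>. v (p (\<epsilon> * (x - a)) \<tau>) (s (\<epsilon> * (x - a)))) has_real_derivative vt) (at (t + b))" and
    eqs: "px + ut = 0" "ux - vt = 0"
    unfolding euler_at_def by blast
  have dx: "((\<lambda>\<xi>. \<epsilon> * (\<xi> - a)) has_real_derivative \<epsilon>) (at x)"
    by (auto intro!: derivative_eq_intros)
  have dt: "((\<lambda>\<tau>. \<tau> + b) has_real_derivative 1) (at t)"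
    by (auto intro!: derivative_eq_intros)
  have "((\<lambda>\<xi>. p \<xi> t) has_real_derivative \<epsilon> * px) (at x)"
    using DERIV_chain2[OF px dx] by (simp add: p mult.commute[of px])
  moreover have "((\<lambda>\<tau>. u x \<tau>) has_real_derivative \<epsilon> * ut) (at t)"
    using DERIV_cmult[OF DERIV_chain2[OF ut dt], of \<epsilon>] by (simp add: u \<epsilon>)
  moreover have "((\<lambda>\<xi>. u \<xi> t) has_real_derivative ux) (at x)"
    using DERIV_cmult[OF DERIV_chain2[OF ux dx], of \<epsilon>] by (simp add: u \<epsilon> mult.commute[of ux])
  moreover have "((\<lambda>\<tau>. v (p x \<tau>) (s x)) has_real_derivative vt) (at t)"
    using DERIV_chain2[OF vt dt] by (simp add: p s)
  moreover have "\<epsilon> * px + \<epsilon> * ut = 0" using eqs by (simp add: distrib_left[symmetric])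
  ultimately show ?thesis unfolding euler_at_def using eqs(2) by blast
qed

lemma euler_at_cong_open:
  assumes "open X" "x \<in> X" and eq: "\<And>\<xi>. \<xi> \<in> X \<Longrightarrow> P \<xi> = p \<xi> \<and> U \<xi> = u \<xi>" and "S x = s x"
    and eu: "euler_at v s p u x t"
  shows "euler_at v S P U x t"
proof -
  have "\<forall>\<^sub>F \<xi> in nhds x. \<xi> \<in> X" using assms(1,2) by (rule eventually_nhds_in_open)
  then have "\<forall>\<^sub>F \<xi> in nhds x. p \<xi> t = P \<xi> t" "\<forall>\<^sub>F \<xi> in nhds x. u \<xi> t = U \<xi> t"
    by (auto elim!: eventually_mono simp: eq)
  then have "((\<lambda>\<xi>. p \<xi> t) has_real_derivative d) (at x) \<longleftrightarrow> ((\<lambda>\<xi>. P \<xi> t) has_real_derivative d) (at x)"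
    "((\<lambda>\<xi>. u \<xi> t) has_real_derivative d) (at x) \<longleftrightarrow> ((\<lambda>\<xi>. U \<xi> t) has_real_derivative d) (at x)" for d
    by (simp_all only: DERIV_cong_ev[OF refl _ refl])
  then show ?thesis using eu eq[OF assms(2)] assms(4) unfolding euler_at_def by simp
qed

text \<open>The closed strips form a locally finite cover: near a point of the strip of index \<open>k\<close> other
  than its right end, only the strips of index \<open>k - 1\<close> and \<open>k\<close> matter.\<close>

lemma continuous_on_strips:
  fixes f :: "real \<times> real \<Rightarrow> real"
  assumes "0 < l"
    and strip: "\<And>k::int. continuous_on ({of_int k * l..of_int (k + 1) * l} \<times> UNIV) f"
  shows "continuous_on UNIV f"
proof (rule continuous_at_imp_continuous_on, rule ballI)
  fix z :: "real \<times> real"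
  define k where "k = \<lfloor>fst z / l\<rfloor>"
  let ?O = "{of_int (k - 1) * l<..<of_int (k + 1) * l} \<times> (UNIV :: real set)"
  have "continuous_on ({of_int (k - 1) * l..of_int k * l} \<times> UNIV \<union>
      {of_int k * l..of_int (k + 1) * l} \<times> UNIV) f"
    using strip[of "k - 1"] strip[of k]
    by (intro continuous_on_closed_Un closed_Times) simp_all
  moreover have "?O \<subseteq> {of_int (k - 1) * l..of_int k * l} \<times> UNIV \<union>
      {of_int k * l..of_int (k + 1) * l} \<times> UNIV"
    by auto
  ultimately have "continuous_on ?O f" by (rule continuous_on_subset)
  moreover have "z \<in> ?O"
    using in_strip[OF assms(1), of "fst z"] assms(1)
    by (cases z) (auto simp: k_def algebra_simps)
  moreover have "open ?O" by (intro open_Times) simp_all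
  ultimately show "isCont f z" by (metis continuous_on_eq_continuous_at)
qed

lemma continuous_on_via_tile:
  fixes f :: "real \<Rightarrow> real \<Rightarrow> real"
  assumes tile: "continuous_on ({0..l} \<times> UNIV) (\<lambda>(x, t). f x t)" and "0 < l"
    and grp: "\<And>\<epsilon> n x t. \<epsilon> \<in> {1, - 1} \<Longrightarrow>
      f x t = w \<epsilon> * f (\<epsilon> * (x - of_int n * (2 * l))) (t + of_int n * c)"
  shows "continuous_on UNIV (\<lambda>(x, t). f x t)"
proof (rule continuous_on_strips[OF \<open>0 < l\<close>])
  fix k :: int
  obtain n :: int and \<epsilon> :: real where \<epsilon>: "\<epsilon> \<in> {1, - 1}" and
    map: "\<And>x. x \<in> {of_int k * l..of_int (k + 1) * l} \<Longrightarrow> \<epsilon> * (x - of_int n * (2 * l)) \<in> {0..l}"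
    using strip_to_tile by metis
  let ?g = "\<lambda>z. (\<epsilon> * (fst z - of_int n * (2 * l)), snd z + of_int n * c)"
  have "continuous_on ({of_int k * l..of_int (k + 1) * l} \<times> UNIV)
      (\<lambda>z. w \<epsilon> * (case ?g z of (x, t) \<Rightarrow> f x t))"
    using map by (intro continuous_on_mult continuous_on_const continuous_on_compose2[OF tile]
        continuous_intros) auto
  moreover have "(\<lambda>z. w \<epsilon> * (case ?g z of (x, t) \<Rightarrow> f x t)) = (\<lambda>(x, t). f x t)"
    using grp[OF \<epsilon>] by (auto simp: fun_eq_iff)
  ultimately show "continuous_on ({of_int k * l..of_int (k + 1) * l} \<times> UNIV) (\<lambda>(x, t). f x t)"
    by (simp only:)
qed

lemma AE_lborel_iff_negligible:
  fixes Q :: "'a::euclidean_space \<Rightarrow> bool"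
  shows "(AE z in lborel. Q z) \<longleftrightarrow> negligible {z. \<not> Q z}"
proof -
  have "(AE z in lborel. Q z) \<longleftrightarrow> (AE z in lebesgue. Q z)" by (simp only: AE_completion_iff)
  then show ?thesis by (simp add: completion.AE_iff_null_sets negligible_iff_null_sets)
qed

lemma AE_lborel_group:
  fixes Q :: "real \<times> real \<Rightarrow> bool"
  assumes "\<epsilon> \<in> {1, - 1}" and "AE z in lborel. Q z"
  shows "AE z in lborel. Q (\<epsilon> * (fst z - a), snd z + b)"
proof -
  let ?h = "\<lambda>z::real \<times> real. (\<epsilon> * fst z + a, snd z - b)"
  have "negligible {z. \<not> Q z}" using assms(2) by (simp only: AE_lborel_iff_negligible)
  moreover have "?h differentiable_on {z. \<not> Q z}"
    unfolding differentiable_on_def differentiable_def by (auto intro!: derivative_eq_intros exI)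
  ultimately have "negligible (?h ` {z. \<not> Q z})"
    by (intro negligible_differentiable_image_negligible order_refl)
  moreover have "{z. \<not> Q (\<epsilon> * (fst z - a), snd z + b)} \<subseteq> ?h ` {z. \<not> Q z}"
  proof
    fix z assume "z \<in> {z. \<not> Q (\<epsilon> * (fst z - a), snd z + b)}"
    moreover have "z = ?h (\<epsilon> * (fst z - a), snd z + b)"
      using assms(1) by (auto simp: prod_eq_iff)
    ultimately show "z \<in> ?h ` {z. \<not> Q z}" by blast
  qed
  ultimately show ?thesis unfolding AE_lborel_iff_negligible by (rule negligible_subset)
qed

lemma AE_lborel_fst_neq: "AE z in (lborel :: (real \<times> real) measure). fst z \<noteq> a"
proof -
  have "negligible {z :: real \<times> real. z \<bullet> (1, 0) = a}"
    by (rule negligible_standard_hyperplane) (simp add: Basis_prod_def)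
  then show ?thesis by (simp add: AE_lborel_iff_negligible inner_prod_def)
qed

text \<open>The equations hold at almost every point because the plane is covered by countably many images
  of the tile under measure-preserving symmetries of the system.  Image points of the tile's boundary
  are discarded, since there the derivatives in \<open>x\<close> involve values from outside the tile.\<close>

lemma classical_solution_extension:
  assumes "0 < l" and sym: "reflection_symmetric l c P U"
    and agree: "\<And>x. x \<in> {0..l} \<Longrightarrow> P x = p x \<and> U x = u x"
    and sol: "classical_solution D v s {0..l} p u"
  shows "classical_solution D v (even_periodic_ext l s) UNIV P U"
proof -
  note grp = reflection_symmetric_group[OF sym]
  have "continuous_on UNIV (\<lambda>(x, t). P x t)"
  proof (rule continuous_on_via_tile[where w = "\<lambda>_. 1" and c = c, OF _ \<open>0 < l\<close>])
    have "continuous_on ({0..l} \<times> UNIV) (\<lambda>(x, t). p x t)"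
      using sol by (simp add: classical_solution_def)
    then show "continuous_on ({0..l} \<times> UNIV) (\<lambda>(x, t). P x t)"
      by (rule continuous_on_eq) (use agree in auto)
  qed (simp add: grp(1))
  moreover have "continuous_on UNIV (\<lambda>(x, t). U x t)"
  proof (rule continuous_on_via_tile[where w = "\<lambda>\<epsilon>. \<epsilon>" and c = c, OF _ \<open>0 < l\<close>])
    have "continuous_on ({0..l} \<times> UNIV) (\<lambda>(x, t). u x t)"
      using sol by (simp add: classical_solution_def)
    then show "continuous_on ({0..l} \<times> UNIV) (\<lambda>(x, t). U x t)"
      by (rule continuous_on_eq) (use agree in auto)
  qed (auto simp: grp(2))
  moreover have "P x t \<in> D" for x t
  proof -
    obtain n :: int and \<epsilon> :: real where \<epsilon>: "\<epsilon> \<in> {1, - 1}"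
      and "\<epsilon> * (x - of_int n * (2 * l)) \<in> {0..l}"
      using point_to_tile[OF \<open>0 < l\<close>] by metis
    then have "P (\<epsilon> * (x - of_int n * (2 * l))) (t + of_int n * c) \<in> D"
      using agree sol by (simp add: classical_solution_def)
    then show ?thesis by (simp only: grp(1)[OF \<epsilon>])
  qed
  moreover have "AE z in lborel. euler_at v (even_periodic_ext l s) P U (fst z) (snd z)"
  proof -
    let ?Q = "\<lambda>z. fst z \<in> {0..l} \<longrightarrow> euler_at v s p u (fst z) (snd z)"
    have Q: "AE z in lborel. ?Q z" using sol by (simp add: classical_solution_def)
    have "AE z in lborel. \<forall>n::int. ?Q (\<epsilon> * (fst z - of_int n * (2 * l)), snd z + of_int n * c)"
      if "\<epsilon> \<in> {1, - 1}" for \<epsilon>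
      unfolding AE_all_countable by (intro allI AE_lborel_group[OF that Q])
    then have "AE z in lborel. \<forall>\<epsilon>\<in>{1, - 1}. \<forall>n::int.
        ?Q (\<epsilon> * (fst z - of_int n * (2 * l)), snd z + of_int n * c)"
      by (intro AE_ball_countable') simp_all
    moreover have "AE z in (lborel :: (real \<times> real) measure). \<forall>k::int. fst z \<noteq> of_int k * l"
      unfolding AE_all_countable by (intro allI AE_lborel_fst_neq)
    ultimately show ?thesis
    proof eventually_elim
      case (elim z)
      obtain n :: int and \<epsilon> :: real where \<epsilon>: "\<epsilon> \<in> {1, - 1}"
        and tile: "\<epsilon> * (fst z - of_int n * (2 * l)) \<in> {0..l}"
        using point_to_tile[OF \<open>0 < l\<close>] by metis
      let ?x = "\<epsilon> * (fst z - of_int n * (2 * l))" and ?t = "snd z + of_int n * c"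
      define d where "d = fst z - of_int n * (2 * l)"
      have "d \<noteq> 0" "d \<noteq> l" "d \<noteq> - l"
        using elim(2)[rule_format, of "2 * n"] elim(2)[rule_format, of "2 * n + 1"]
          elim(2)[rule_format, of "2 * n - 1"]
        by (auto simp: d_def algebra_simps)
      then have int: "?x \<in> {0<..<l}" using tile \<epsilon> unfolding d_def[symmetric] by auto
      have eu: "euler_at v s p u ?x ?t"
        using elim(1)[rule_format, OF \<epsilon>, of n] tile by (simp only: fst_conv snd_conv)
      have "euler_at v (even_periodic_ext l s) P U ?x ?t"
      proof (rule euler_at_cong_open[OF open_greaterThanLessThan int])
        show "P \<xi> = p \<xi> \<and> U \<xi> = u \<xi>" if "\<xi> \<in> {0<..<l}" for \<xi>
          using that by (intro agree) simp
        show "even_periodic_ext l s ?x = s ?x" by (rule even_periodic_ext_eq[OF \<open>0 < l\<close> tile])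
      qed (rule eu)
      then show ?case
        by (rule euler_at_group[where a = "of_int n * (2 * l)" and b = "of_int n * c", rotated 4])
          (use \<epsilon> in \<open>simp_all only: grp even_periodic_ext_group[OF \<open>0 < l\<close>]\<close>)
    qed
  qed
  ultimately show ?thesis by (simp add: classical_solution_def)
qed


section \<open>Matching conditions from the scalar equations\<close>

lemma parts_of_even_plus_odd:
  assumes "even_fun f" and "odd_fun g"
  shows "even_part (\<lambda>t. f t + g t) = f" and "odd_part (\<lambda>t. f t + g t) = g"
  using assms by (auto simp: even_part_def odd_part_def reflect_def even_fun_def odd_fun_def)

lemma F_A_matching:
  assumes "even_fun f" and "odd_fun g" and "odd_part (\<lambda>t. f t + g t) = (\<lambda>t. 0)"
  shows "g t = 0"
  using assms parts_of_even_plus_odd(2)[OF assms(1,2)] by metis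

text \<open>Evenness about \<open>T / 4\<close> of \<open>f + g\<close> and the parities about \<open>0\<close> give
  \<open>f(r + T/2) - f(r) + g(r + T/2) + g(r) = 0\<close>.  By periodicity, the difference of the first two terms
  is even in \<open>r\<close> and the sum of the last two is odd, hence each vanishes.\<close>

lemma F_P_matching:
  assumes ev: "even_fun f" and od: "odd_fun g" and per: "periodic T f" "periodic T g"
    and eq: "odd_part (shift (- (T / 4)) (\<lambda>t. f t + g t)) = (\<lambda>t. 0)"
  shows "f (r + T / 2) = f r" and "g (r + T / 2) = - g r"
proof -
  have main: "f (r + T / 2) - f r + (g (r + T / 2) + g r) = 0" for r
  proof -
    have "f (r + T / 4 + T / 4) + g (r + T / 4 + T / 4) = f (- r) + g (- r)"
      using fun_cong[OF eq, of "r + T / 4"] by (simp add: odd_part_def shift_def reflect_def)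
    moreover have "f (r + T / 4 + T / 4) = f (r + T / 2)" "g (r + T / 4 + T / 4) = g (r + T / 2)"
      by (simp_all add: add.commute)
    moreover have "f (- r) = f r" "g (- r) = - g r"
      using ev od by (simp_all add: even_fun_def odd_fun_def)
    ultimately show ?thesis by linarith
  qed
  have "f (- r + T / 2) = f (r + T / 2)" "g (- r + T / 2) = - g (r + T / 2)"
  proof -
    have "f (- r + T / 2) = f (r - T / 2)" "g (- r + T / 2) = - g (r - T / 2)"
      using ev od by (metis even_fun_def odd_fun_def minus_diff_eq uminus_add_conv_diff)+
    moreover have "f (r - T / 2) = f (r + T / 2)" "g (r - T / 2) = g (r + T / 2)"
      using per[unfolded periodic_def, rule_format, of "r - T / 2"]
      by (simp_all add: add.commute)
    ultimately show "f (- r + T / 2) = f (r + T / 2)" "g (- r + T / 2) = - g (r + T / 2)" by simp_all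
  qed
  moreover have "f (- r) = f r" "g (- r) = - g r" using ev od by (simp_all add: even_fun_def odd_fun_def)
  ultimately show "f (r + T / 2) = f r" "g (r + T / 2) = - g r"
    using main[of r] main[of "- r"] by linarith+
qed


section \<open>Space-time periodic solutions\<close>

text \<open>The common part of both cases: \<open>c = T / 2\<close> belongs to \<open>F_P\<close> and \<open>c = 0\<close> to
  \<open>F_A\<close>.  The spatial period is left implicit in the translation law, as it depends on whether
  \<open>c\<close> itself or only \<open>2 c\<close> is a period in time.\<close>

lemma periodic_solution_from_tile:
  assumes "0 < l" and tile: "tile_solution D v s l T y0 p u" and "even_fun y0"
    and y: "\<And>x. x \<in> {0..l} \<Longrightarrow> y x = (\<lambda>t. p x t + u x t)"
    and per: "\<And>x. x \<in> {0..l} \<Longrightarrow> periodic (2 * c) (p x) \<and> periodic (2 * c) (u x)"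
    and match: "\<And>t. p l (t + c) = p l t" "\<And>t. u l (t + c) = - u l t"
  obtains P U where "generated_by_tile l c y P U"
    and "classical_solution D v (even_periodic_ext l s) UNIV P U"
    and "\<And>x t. P (x + 2 * l) t = P x (t + c)" "\<And>x t. U (x + 2 * l) t = U x (t + c)"
    and "\<And>x. periodic T (P x) \<and> periodic T (U x)"
proof -
  have "u 0 t = 0" for t
    using tile \<open>even_fun y0\<close> by (simp add: tile_solution_def odd_part_def reflect_def even_fun_def)
  then obtain P U where sym: "reflection_symmetric l c P U"
    and agree: "\<And>x. x \<in> {0..l} \<Longrightarrow> P x = p x \<and> U x = u x"
    using tile_extension_exists[where p = p and u = u and c = c, OF \<open>0 < l\<close> per _ match] by metis
  note grp = reflection_symmetric_group[OF sym]
  have "generated_by_tile l c y P U"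
    using sym tile agree parts_of_even_plus_odd
    by (simp add: generated_by_tile_def reflection_symmetric_def y tile_solution_def)
  moreover have "classical_solution D v (even_periodic_ext l s) UNIV P U"
    using classical_solution_extension[OF \<open>0 < l\<close> sym agree] tile by (simp add: tile_solution_def)
  moreover have "P (x + 2 * l) t = P x (t + c)" "U (x + 2 * l) t = U x (t + c)" for x t
    using reflection_symmetric_translation[OF sym, of x 1 t] by simp_all
  moreover have "periodic T (P x) \<and> periodic T (U x)" for x
  proof -
    obtain n :: int and \<epsilon> :: real where \<epsilon>: "\<epsilon> \<in> {1, - 1}"
      and in_tile: "\<epsilon> * (x - of_int n * (2 * l)) \<in> {0..l}"
      using point_to_tile[OF \<open>0 < l\<close>] by metis
    let ?x = "\<epsilon> * (x - of_int n * (2 * l))"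
    have "p ?x (t + of_int n * c) = P x t" "u ?x (t + of_int n * c) = \<epsilon> * U x t" for t
      using grp[OF \<epsilon>, of x n t] agree[OF in_tile] by simp_all
    moreover have "p ?x (t + T + of_int n * c) = p ?x (t + of_int n * c)"
      "u ?x (t + T + of_int n * c) = u ?x (t + of_int n * c)" for t
      using tile in_tile unfolding tile_solution_def periodic_def by (metis add.assoc add.commute)+
    ultimately show ?thesis using \<epsilon> by (auto simp: periodic_def)
  qed
  ultimately show ?thesis using that by blast
qed

theorem theorem2p1:
  fixes D :: "real set" and v :: "real \<Rightarrow> real \<Rightarrow> real" and s :: "real \<Rightarrow> real"
    and l T :: real
    and E :: "real \<Rightarrow> (real \<Rightarrow> real) \<Rightarrow> real \<Rightarrow> real"
    and y0 :: "real \<Rightarrow> real"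
  assumes "0 < l" and "0 < T"
    and "constitutive D v"
    and "piecewise_C1 l s"
    and "evolution_operator D v s l T E"
    and "even_fun y0" and "periodic T y0"
    and "\<exists>p u. tile_solution D v s l T y0 p u"
  shows "(F_P E l T y0 = (\<lambda>t. 0) \<longrightarrow>
           (\<exists>p u. generated_by_tile l (T / 2) (\<lambda>x. E x y0) p u \<and>
                  classical_solution D v (even_periodic_ext l s) UNIV p u \<and>
                  periodic (4 * l) p \<and> periodic (4 * l) u \<and>
                  (\<forall>x. periodic T (p x) \<and> periodic T (u x)))) \<and>
         (F_A E l y0 = (\<lambda>t. 0) \<longrightarrow>
           (\<exists>p u. generated_by_tile l 0 (\<lambda>x. E x y0) p u \<and>
                  classical_solution D v (even_periodic_ext l s) UNIV p u \<and>
                  periodic (2 * l) p \<and> periodic (2 * l) u \<and>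
                  (\<forall>x. periodic T (p x) \<and> periodic T (u x))))"
proof -
  obtain p u where tile: "tile_solution D v s l T y0 p u"
    and y: "\<And>x. x \<in> {0..l} \<Longrightarrow> E x y0 = (\<lambda>t. p x t + u x t)"
    using assms(5,8) unfolding evolution_operator_def by blast
  have l: "l \<in> {0..l}" using \<open>0 < l\<close> by simp
  have per: "periodic T (p x) \<and> periodic T (u x)" if "x \<in> {0..l}" for x
    using tile that by (simp add: tile_solution_def)
  have par: "even_fun (p l)" "odd_fun (u l)" using tile l by (simp_all add: tile_solution_def)
  note gen = periodic_solution_from_tile[OF \<open>0 < l\<close> tile \<open>even_fun y0\<close>, where y = "\<lambda>x. E x y0", OF y]
  show ?thesis
  proof (intro conjI impI)
    assume "F_P E l T y0 = (\<lambda>t. 0)"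
    then have eq: "odd_part (shift (- (T / 4)) (\<lambda>t. p l t + u l t)) = (\<lambda>t. 0)"
      by (simp add: F_P_def y[OF l])
    note match = F_P_matching[OF par _ _ eq]
    obtain P U where PU: "generated_by_tile l (T / 2) (\<lambda>x. E x y0) P U"
      "classical_solution D v (even_periodic_ext l s) UNIV P U"
      "\<And>x. periodic T (P x) \<and> periodic T (U x)"
      and step: "\<And>x t. P (x + 2 * l) t = P x (t + T / 2)" "\<And>x t. U (x + 2 * l) t = U x (t + T / 2)"
      by (rule gen[where c = "T / 2"]) (use per match per[OF l] in auto)
    have "x + 4 * l = x + 2 * l + 2 * l" "t + T / 2 + T / 2 = t + T" for x t by simp_all
    then have "P (x + 4 * l) t = P x t" "U (x + 4 * l) t = U x t" for x t
      using PU(3)[of x] by (simp_all only: step periodic_def)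
    then have "periodic (4 * l) P" "periodic (4 * l) U" by (auto simp: periodic_def)
    then show "\<exists>p u. generated_by_tile l (T / 2) (\<lambda>x. E x y0) p u \<and>
        classical_solution D v (even_periodic_ext l s) UNIV p u \<and>
        periodic (4 * l) p \<and> periodic (4 * l) u \<and>
        (\<forall>x. periodic T (p x) \<and> periodic T (u x))"
      using PU by blast
  next
    assume "F_A E l y0 = (\<lambda>t. 0)"
    then have "odd_part (\<lambda>t. p l t + u l t) = (\<lambda>t. 0)" by (simp add: F_A_def y[OF l])
    note match = F_A_matching[OF par this]
    obtain P U where PU: "generated_by_tile l 0 (\<lambda>x. E x y0) P U"
      "classical_solution D v (even_periodic_ext l s) UNIV P U"
      "\<And>x. periodic T (P x) \<and> periodic T (U x)"
      and step: "\<And>x t. P (x + 2 * l) t = P x (t + 0)" "\<And>x t. U (x + 2 * l) t = U x (t + 0)"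
      by (rule gen[where c = 0]) (use match in \<open>auto simp: periodic_def\<close>)
    have "periodic (2 * l) P" "periodic (2 * l) U" using step by (auto simp: periodic_def)
    then show "\<exists>p u. generated_by_tile l 0 (\<lambda>x. E x y0) p u \<and>
        classical_solution D v (even_periodic_ext l s) UNIV p u \<and>
        periodic (2 * l) p \<and> periodic (2 * l) u \<and>
        (\<forall>x. periodic T (p x) \<and> periodic T (u x))"
      using PU by blast
  qed
qed

end
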